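(* Let $t_1,t_2,h'_1,h'_2,l'_1,l'_2,\alpha'_1,\alpha'_2,\beta'$, $\mu_0,\alpha_1$ be complex parameters, and let $\xi\neq0$ be either independent of $x$ or of the form $\xi=Ax$ with $A$ independent of $x$. Assume that the function $h(s)$ satisfies $$A^{\langle 4 \rangle} \big( s; h'_1, h'_2, l'_1, l'_2, \alpha '_1, \alpha '_2, \beta ' \big) h(s) = E' h(s)$$ and $$\lim _{L \to +\infty } \frac{h(s)}{s^{(h'_1 + h'_2 - l'_1 - l'_2 - \alpha '_1 - \alpha '_2 + \beta ' +2)/2}} \Big| _{s=q^{L} \xi } = C_1, \qquad \lim _{K \to -\infty } \frac{h(s)}{s^{-\alpha ' _1}} \Big| _{s=q^{K} \xi } = C_2$$ for some constants $E'$, $C_1$, $C_2$. Set \begin{gather*} \chi = \big( l'_1 + l'_2 - h'_1 - h'_2 - \alpha '_1 + \alpha '_2 - \beta ' \big)/2 , \qquad \mu = \mu _0 + 1+ \chi , \\ E = q^{\mu _0 + \alpha _1 - \alpha ' _1 } E', \qquad \beta = - \beta ' - \chi , \qquad \alpha _2 = \alpha _1 - \alpha ' _1 + \alpha ' _2 - \chi , \\ l_i = l'_i +\mu _0 , \qquad h_i = h'_i +\mu _0 +\chi , \qquad i=1,2. \end{gather*} Then the Jackson integral $$g (x) = x^{- \alpha _1} \int^{\xi \infty }_{0} s^{-(h'_1 + h'_2 - l'_1 - l'_2 - \alpha '_1 - \alpha '_2 + \beta ' +2)/2} h(s) P^{(1)}_{\mu ,\mu _0 } (x,s)\, {\rm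 d}_{q}s$$ converges and it satisfies $$A^{\langle 4 \rangle} ( x; h_1, h_2, l_1, l_2, \alpha _1, \alpha _2, \beta ) g (x) = E g(x) + (1-q) (g_2 (x) - g_1 (x)),$$ where \begin{gather*} g_1 (x)= C_1 x^{- \alpha _1} q^{\mu _0 + \alpha _1 + h'_1 + h'_2 + \chi } \big( q^{ \beta ' } - 1 \big) t_1 t_2 , \\ g_2(x)= C_2 x^{- \alpha _1 } \frac{\vartheta _q (q^{- \mu _0 - \chi } x/\xi )}{\vartheta _q (q^{- \mu _0 +1 } x/\xi )} \xi ^{\chi + 1 } q^{\mu _0 + \alpha _1 } \big( q^{\alpha ' _2 - \alpha '_1} - 1 \big) . \end{gather*} In particular, if $C_1=C_2=0$, then $$A^{\langle 4 \rangle} ( x; h_1, h_2, l_1, l_2, \alpha _1, \alpha _2, \beta ) g (x) = E g(x) .$$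
   Context: $q$ is a complex number with $0<|q|<1$. Complex powers are taken with a fixed branch of $\log q$, so that $q^a=\exp(a\log q)$ and power functions obey $(q^{\pm1}x)^a=q^{\pm a}x^a$. Formulas are understood at points where all expressions are defined. Notation: $(a;q)_\infty=\prod_{j=0}^\infty(1-q^ja)$, $$\vartheta_q(t)=(t;q)_\infty(q/t;q)_\infty(q;q)_\infty,\qquad P^{(1)}_{\mu ,\mu _0 } (x,s)= \frac{(q^{\mu }s/x;q)_{\infty }}{(q^{\mu _0 }s/x;q)_{\infty }}.$$ The Jackson integral is the bilateral series $$\int^{\xi \infty }_{0}f(s)\, {\rm d}_{q}s = (1-q)\sum^{\infty}_{n=-\infty}q^{n} \xi f(q^n \xi ).$$ If $\xi=Ax$, replacing $x$ by $q^{\pm1}x$ in $g(x)$ also replaces $\xi$ by $q^{\pm1}\xi$. $T_x^{\pm1}$ is the $q$-shift operator, $T_x^{\pm1}g(x)=g(q^{\pm1}x)$. With fixed complex parameters $t_1,t_2$ (the same in all operators), \begin{gather*} A^{\langle 4 \rangle} ( x; h_1, h_2, l_1, l_2, \alpha _1, \alpha _2, \beta ) = x^{-1} (x-q^{h_1 + 1/2} t_1) (x-q^{h_2 +1/2} t_2) T_{x}^{-1} \\ {}+ q^{\alpha _1 +\alpha _2} x^{-1} (x - q^{l_1 -1/2} t_1) (x - q^{l_2 -1/2} t_2) T_{x}\\ {}-\big\{ (q^{\alpha _1} +q^{\alpha _2} ) x + q^{(h_1 +h_2 + l_1 +l_2 +\alpha _1 +\alpha _2 )/2}( q^{\beta/2}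 + q^{-\beta/2} ) t_1 t_2 x^{-1} \big\}, \end{gather*} and $A^{\langle 4 \rangle}(s;\dots)$ is the same operator in the variable $s$. *)

theory Defs
  imports "HOL-Analysis.Analysis"
begin

text \<open>
  Complex powers: \<open>lq\<close> is the fixed branch of \<open>log q\<close>, and \<open>lg\<close> is a choice of
  logarithm on the nonzero complex numbers which is additive under \<open>x \<mapsto> q x\<close>.  Throughout,
  \<open>q\<^sup>a\<close> is written \<open>exp (a * lq)\<close> and the power function \<open>x\<^sup>a\<close> is written
  \<open>exp (a * lg x)\<close>, so that \<open>(q x)\<^sup>a = q\<^sup>a x\<^sup>a\<close>.  The principal branch \<open>Ln\<close> does not satisfy
  this for all \<open>x\<close>; lemma \<open>ex_q_log_branch\<close> shows that suitable \<open>lg\<close> exist.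
\<close>

definition q_log_branch :: "complex \<Rightarrow> complex \<Rightarrow> (complex \<Rightarrow> complex) \<Rightarrow> bool" where
  "q_log_branch q lq lg \<longleftrightarrow>
     exp lq = q \<and> (\<forall>x. x \<noteq> 0 \<longrightarrow> exp (lg x) = x \<and> lg (q * x) = lq + lg x)"

lemma ex_q_log_branch:
  assumes q: "0 < norm q" "norm q < 1" and lq: "exp lq = q"
  shows "\<exists>lg. q_log_branch q lq lg"
proof -
  define N where "N = (\<lambda>x::complex. \<lfloor>ln (norm x) / ln (norm q)\<rfloor>)"
  define lg where "lg = (\<lambda>x. of_int (N x) * lq + Ln (x / q powi N x))"
  have q0: "q \<noteq> 0" and l: "ln (norm q) \<noteq> 0"
    using q by auto
  have "exp (lg x) = x \<and> lg (q * x) = lq + lg x" if x: "x \<noteq> 0" for x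
  proof
    have "exp (of_int (N x) * lq) = q powi N x"
      using exp_power_int[of lq "N x"] lq by simp
    then show "exp (lg x) = x"
      using x q0 by (simp add: lg_def exp_add)
    have "ln (norm (q * x)) / ln (norm q) = ln (norm x) / ln (norm q) + 1"
      using x q0 l by (simp add: norm_mult ln_mult add_divide_distrib)
    then have N: "N (q * x) = N x + 1"
      by (simp add: N_def)
    have "q * x / q powi (N x + 1) = x / q powi N x"
      using q0 by (simp add: power_int_add)
    then show "lg (q * x) = lq + lg x"
      unfolding lg_def N by (simp add: algebra_simps)
  qed
  then show ?thesis
    using lq unfolding q_log_branch_def by blast
qed

definition qpoch_inf :: "complex \<Rightarrow> complex \<Rightarrow> complex" where
  "qpoch_inf q a = (\<Prod>j. 1 - q ^ j * a)"

definition qtheta :: "complex \<Rightarrow> complex \<Rightarrow> complex" where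
  "qtheta q t = qpoch_inf q t * qpoch_inf q (q / t) * qpoch_inf q q"

definition P1 :: "complex \<Rightarrow> complex \<Rightarrow> complex \<Rightarrow> complex \<Rightarrow> complex \<Rightarrow> complex \<Rightarrow> complex" where
  "P1 q lq \<mu> \<mu>0 x s =
     qpoch_inf q (exp (\<mu> * lq) * s / x) / qpoch_inf q (exp (\<mu>0 * lq) * s / x)"

text \<open>Convergence of the bilateral series is unordered summability over the integers, which for
  complex terms means absolute convergence.\<close>

definition jackson_converges :: "complex \<Rightarrow> complex \<Rightarrow> (complex \<Rightarrow> complex) \<Rightarrow> bool" where
  "jackson_converges q \<xi> f \<longleftrightarrow>
     (\<lambda>n::int. q powi n * \<xi> * f (q powi n * \<xi>)) summable_on UNIV"

definition jackson :: "complex \<Rightarrow> complex \<Rightarrow> (complex \<Rightarrow> complex) \<Rightarrow> complex" where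
  "jackson q \<xi> f = (1 - q) * (\<Sum>\<^sub>\<infinity>n::int. q powi n * \<xi> * f (q powi n * \<xi>))"

definition A4 :: "complex \<Rightarrow> complex \<Rightarrow> complex \<Rightarrow> complex \<Rightarrow>
    complex \<Rightarrow> complex \<Rightarrow> complex \<Rightarrow> complex \<Rightarrow> complex \<Rightarrow> complex \<Rightarrow> complex \<Rightarrow>
    (complex \<Rightarrow> complex) \<Rightarrow> complex \<Rightarrow> complex" where
  "A4 q lq t1 t2 h1 h2 l1 l2 \<alpha>1 \<alpha>2 \<beta> g x =
     inverse x * (x - exp ((h1 + 1/2) * lq) * t1) * (x - exp ((h2 + 1/2) * lq) * t2)
       * g (inverse q * x)
   + exp ((\<alpha>1 + \<alpha>2) * lq) * inverse x
       * (x - exp ((l1 - 1/2) * lq) * t1) * (x - exp ((l2 - 1/2) * lq) * t2) * g (q * x)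
   - ((exp (\<alpha>1 * lq) + exp (\<alpha>2 * lq)) * x
      + exp ((h1 + h2 + l1 + l2 + \<alpha>1 + \<alpha>2) / 2 * lq)
          * (exp (\<beta> / 2 * lq) + exp (- \<beta> / 2 * lq)) * t1 * t2 * inverse x) * g x"

end

theory Submission
  imports Defs
begin

text \<open>
  Write \<open>A'\<close> for the operator in \<open>s\<close> that \<open>h\<close> satisfies, \<open>A\<close> for the operator in \<open>x\<close> with the
  shifted parameters, \<open>s\<^sub>n = q\<^sup>n \<xi>\<close> for the points of the Jackson sum and \<open>K(x, s) = x powr
  (-\<alpha>\<^sub>1) s powr (1 - p) P(x, s)\<close>, with \<open>p\<close> the exponent of \<open>s\<close> in the condition at the origin,
  so that \<open>g(x) = (1 - q) \<Sum> K(x, s\<^sub>n) h(s\<^sub>n)\<close>. Here \<open>u powr a\<close> is the power function with the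
  given branch of the logarithm. Two facts carry the theorem.

  First, the kernel intertwines the two operators: applying \<open>A\<close> to \<open>K\<close> in \<open>x\<close> gives, up to the
  factor \<open>\<kappa> = q powr (\<mu>\<^sub>0 + \<alpha>\<^sub>1 - \<alpha>'\<^sub>1)\<close>, the same function as applying to \<open>K\<close> in \<open>s\<close> the
  transpose of \<open>A'\<close> with respect to summation over the lattice (lemma \<open>A4_kernel_duality\<close>).
  Since \<open>P\<close> depends on \<open>s/x\<close> only, a shift of \<open>x\<close> is an inverse shift of \<open>s\<close>, and by the
  first-order recurrence of \<open>P\<close> this is an identity between rational functions. Its source is a
  factorisation: in the coefficient of each shifted kernel the difference between the two sides
  contains exactly the linear factor by which the recurrence turns that shifted kernel back into
  \<open>P(x, s)\<close> (lemma \<open>kernel_identity\<close>).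

  Secondly, moving the transpose back onto \<open>h\<close> is a summation by parts. With \<open>W\<^sub>n = K\<^sub>n b(s\<^sub>n)
  h(s\<^sub>n\<^sub>+\<^sub>1) - K\<^sub>n\<^sub>+\<^sub>1 a(s\<^sub>n\<^sub>+\<^sub>1) h(s\<^sub>n)\<close>, where \<open>a\<close> and \<open>b\<close> are the coefficients of the two
  shifts in \<open>A'\<close>, the summand of \<open>(A - \<kappa> E') g\<close> is \<open>(1 - q) \<kappa> (W\<^sub>n\<^sub>-\<^sub>1 - W\<^sub>n)\<close>. The bilateral
  sum telescopes, and only the limits of \<open>W\<close> at the two ends survive. At \<open>s \<rightarrow> 0\<close>, where \<open>P \<rightarrow> 1\<close>,
  the limit yields \<open>g\<^sub>1\<close>. At \<open>s \<rightarrow> \<infinity>\<close> the quotient \<open>P\<close> behaves like a power of \<open>s\<close> times a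
  quotient of theta functions (lemma \<open>P1_at_bot\<close>), and the limit yields \<open>g\<^sub>2\<close>. The same
  asymptotics show that the summands decay geometrically in both directions, hence convergence.
\<close>

section \<open>The q-Pochhammer symbol\<close>

lemma
  assumes "norm q < 1"
  shows qpoch_inf_LIMSEQ: "(\<lambda>n. \<Prod>j<n. 1 - q ^ j * a) \<longlonglongrightarrow> qpoch_inf q a"
    and qpoch_inf_eq_0_iff: "qpoch_inf q a = 0 \<longleftrightarrow> (\<exists>j. q ^ j * a = 1)"
proof -
  have "summable (\<lambda>j. norm (1 - q ^ j * a - 1))"
    using assms by (simp add: norm_mult norm_power summable_mult2)
  then have c: "convergent_prod (\<lambda>j. 1 - q ^ j * a)"
    by (intro abs_convergent_prod_imp_convergent_prod) (simp add: abs_convergent_prod_conv_summable)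
  have "(\<lambda>n. \<Prod>j\<le>n. 1 - q ^ j * a) \<longlonglongrightarrow> qpoch_inf q a"
    using convergent_prod_LIMSEQ[OF c] by (simp add: qpoch_inf_def)
  then show "(\<lambda>n. \<Prod>j<n. 1 - q ^ j * a) \<longlonglongrightarrow> qpoch_inf q a"
    by (subst filterlim_sequentially_Suc[symmetric]) (simp add: lessThan_Suc_atMost)
  show "qpoch_inf q a = 0 \<longleftrightarrow> (\<exists>j. q ^ j * a = 1)"
    using has_prod_eq_0_iff[OF convergent_prod_has_prod[OF c]] unfolding qpoch_inf_def
    by (auto simp: eq_commute[of 1])
qed

lemma qpoch_inf_rec:
  assumes "norm q < 1"
  shows "qpoch_inf q a = (1 - a) * qpoch_inf q (q * a)"
proof (rule LIMSEQ_unique)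
  show "(\<lambda>n. \<Prod>j<Suc n. 1 - q ^ j * a) \<longlonglongrightarrow> qpoch_inf q a"
    using qpoch_inf_LIMSEQ[OF assms] by (subst filterlim_sequentially_Suc)
  show "(\<lambda>n. \<Prod>j<Suc n. 1 - q ^ j * a) \<longlonglongrightarrow> (1 - a) * qpoch_inf q (q * a)"
    unfolding prod.lessThan_Suc_shift
    using tendsto_mult_left[OF qpoch_inf_LIMSEQ[OF assms, of "q * a"], of "1 - a"]
    by (simp add: mult_ac)
qed

text \<open>
  Each partial product satisfies the same bound, because \<open>1 + t \<le> exp t\<close> turns the product of
  the moduli into the exponential of a geometric sum.
\<close>

lemma norm_qpoch_inf_minus_1_le:
  assumes q: "norm q < 1"
  shows "norm (qpoch_inf q a - 1) \<le> exp (norm a / (1 - norm q)) - 1"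
proof (rule tendsto_upperbound)
  show "(\<lambda>n. norm ((\<Prod>j<n. 1 - q ^ j * a) - 1)) \<longlonglongrightarrow> norm (qpoch_inf q a - 1)"
    by (intro tendsto_intros qpoch_inf_LIMSEQ q)
  have "norm ((\<Prod>j<n. 1 - q ^ j * a) - 1) \<le> exp (norm a / (1 - norm q)) - 1" for n
  proof -
    have "norm ((\<Prod>j<n. 1 + - (q ^ j * a)) - 1) \<le> (\<Prod>j<n. 1 + norm (- (q ^ j * a))) - 1"
      by (rule norm_prod_minus1_le_prod_minus1)
    also have "(\<Prod>j<n. 1 + norm (- (q ^ j * a))) \<le> (\<Prod>j<n. exp (norm (- (q ^ j * a))))"
      by (intro prod_mono) (auto simp: exp_ge_add_one_self add_nonneg_nonneg)
    also have "\<dots> = exp ((\<Sum>j<n. norm q ^ j) * norm a)"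
      by (simp add: exp_sum norm_mult norm_power sum_distrib_right)
    also have "(\<Sum>j<n. norm q ^ j) \<le> 1 / (1 - norm q)"
      using q by (subst suminf_geometric[symmetric]) (auto intro!: sum_le_suminf)
    finally show ?thesis by (simp add: mult_right_mono)
  qed
  then show "\<forall>\<^sub>F n in sequentially. norm ((\<Prod>j<n. 1 - q ^ j * a) - 1)
      \<le> exp (norm a / (1 - norm q)) - 1" by simp
qed simp

lemma tendsto_qpoch_inf_1:
  assumes "norm q < 1" and f: "(f \<longlongrightarrow> 0) F"
  shows "((\<lambda>y. qpoch_inf q (f y)) \<longlongrightarrow> 1) F"
proof -
  have "((\<lambda>y. exp (norm (f y) / (1 - norm q)) - 1) \<longlongrightarrow> exp (norm (0::complex) / (1 - norm q)) - 1) F"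
    using assms by (intro tendsto_intros f) auto
  then have "((\<lambda>y. exp (norm (f y) / (1 - norm q)) - 1) \<longlongrightarrow> 0) F" by simp
  then have "((\<lambda>y. qpoch_inf q (f y) - 1) \<longlongrightarrow> 0) F"
    by (rule Lim_null_comparison[rotated]) (use assms norm_qpoch_inf_minus_1_le in auto)
  then show ?thesis by (simp add: LIM_zero_iff)
qed

text \<open>
  Moving both arguments outwards by a factor \<open>1/q\<close> adds the factors \<open>1 - a/q\<^sup>N\<^sup>+\<^sup>1 = -
  (a/q\<^sup>N\<^sup>+\<^sup>1) (1 - q\<^sup>N (q/a))\<close> and likewise for \<open>b\<close>. The monomials contribute \<open>(a/b)\<^sup>N\<close>, and
  what is left are the partial products of the second factors of the theta functions.
\<close>

lemma qpoch_inf_quotient_backward: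
  assumes q: "q \<noteq> 0" "norm q < 1" and a: "a \<noteq> 0" and b: "b \<noteq> 0"
    and nz: "\<And>N. qpoch_inf q (b / q ^ N) \<noteq> 0"
  shows "(b / a) ^ N * (qpoch_inf q (a / q ^ N) / qpoch_inf q (b / q ^ N)) =
      qpoch_inf q a * (\<Prod>j<N. 1 - q ^ j * (q / a)) / (qpoch_inf q b * (\<Prod>j<N. 1 - q ^ j * (q / b)))"
proof (induction N)
  case (Suc N)
  have rec: "qpoch_inf q (y / q ^ Suc N) = - (y / q ^ Suc N) * (1 - q ^ N * (q / y)) * qpoch_inf q (y / q ^ N)"
    if "y \<noteq> 0" for y
  proof -
    have "qpoch_inf q (y / q ^ Suc N) = (1 - y / q ^ Suc N) * qpoch_inf q (y / q ^ N)"
      using qpoch_inf_rec[OF q(2), of "y / q ^ Suc N"] q by simp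
    also have "1 - y / q ^ Suc N = - (y / q ^ Suc N) * (1 - q ^ N * (q / y))"
      using q that by (simp add: field_simps)
    finally show ?thesis .
  qed
  have "1 - q ^ N * (q / b) \<noteq> 0"
    using rec[OF b] nz[of "Suc N"] by auto
  then have "(b / a) ^ Suc N * (qpoch_inf q (a / q ^ Suc N) / qpoch_inf q (b / q ^ Suc N)) =
      ((b / a) ^ N * (qpoch_inf q (a / q ^ N) / qpoch_inf q (b / q ^ N)))
        * ((1 - q ^ N * (q / a)) / (1 - q ^ N * (q / b)))"
    unfolding rec[OF a] rec[OF b] using a b q by (simp add: power_divide mult_ac)
  then show ?case unfolding Suc.IH by (simp add: mult.assoc)
qed simp

lemma qpoch_inf_quotient_backward_LIMSEQ:
  assumes q: "q \<noteq> 0" "norm q < 1" and a: "a \<noteq> 0" and b: "b \<noteq> 0"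
    and nz: "\<And>N. qpoch_inf q (b / q ^ N) \<noteq> 0"
  shows "(\<lambda>N. (b / a) ^ N * (qpoch_inf q (a / q ^ N) / qpoch_inf q (b / q ^ N)))
    \<longlonglongrightarrow> qtheta q (q / a) / qtheta q (q / b)"
proof -
  have "q ^ j * q \<noteq> 1" for j
  proof
    assume "q ^ j * q = 1"
    then have "norm q ^ Suc j = 1" by (metis norm_one norm_power power_Suc2)
    moreover have "norm q ^ Suc j < 1" using q by (intro power_Suc_less_one) auto
    ultimately show False by simp
  qed
  then have qq: "qpoch_inf q q \<noteq> 0" using qpoch_inf_eq_0_iff[OF q(2)] by blast
  \<comment> \<open>A zero of this factor would be a zero of the denominator at one of the points \<open>b / q\<^sup>N\<close>.\<close>
  have qb: "qpoch_inf q (q / b) \<noteq> 0"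
  proof
    assume "qpoch_inf q (q / b) = 0"
    then obtain j where j: "q ^ j * (q / b) = 1" using qpoch_inf_eq_0_iff[OF q(2)] by blast
    then have "b / q ^ Suc j = 1" using q b by (simp add: field_simps)
    then show False
      using nz[of "Suc j"] qpoch_inf_rec[OF q(2), of "b / q ^ Suc j"] by simp
  qed
  have "qpoch_inf q b \<noteq> 0" using nz[of 0] by simp
  then have "(\<lambda>N. qpoch_inf q a * (\<Prod>j<N. 1 - q ^ j * (q / a)) / (qpoch_inf q b * (\<Prod>j<N. 1 - q ^ j * (q / b))))
      \<longlonglongrightarrow> qpoch_inf q a * qpoch_inf q (q / a) / (qpoch_inf q b * qpoch_inf q (q / b))"
    using qb by (intro tendsto_intros qpoch_inf_LIMSEQ q) auto
  moreover have "qtheta q (q / a) / qtheta q (q / b) =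
      qpoch_inf q a * qpoch_inf q (q / a) / (qpoch_inf q b * qpoch_inf q (q / b))"
    using q a b qq by (simp add: qtheta_def field_simps)
  ultimately show ?thesis
    unfolding qpoch_inf_quotient_backward[OF assms] by (simp only:)
qed

section \<open>Bilateral sums\<close>

lemma filterlim_uminus_at_bot_int: "filterlim (uminus :: int \<Rightarrow> int) at_bot at_top"
  unfolding filterlim_at_bot
proof
  fix Z :: int
  show "\<forall>\<^sub>F n in at_top. - n \<le> Z"
    using eventually_ge_at_top[of "- Z"] by eventually_elim simp
qed

text \<open>
  The two limits say that \<open>f n\<close> is at most of the order of \<open>q\<^sup>|\<^sup>n\<^sup>|\<close> in both directions.
\<close>

lemma summable_on_int_if_geometric:
  fixes f :: "int \<Rightarrow> complex"
  assumes q: "q \<noteq> 0" "norm q < 1"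
    and top: "((\<lambda>n. f n / q powi n) \<longlongrightarrow> L) at_top"
    and bot: "((\<lambda>n. f n * q powi n) \<longlongrightarrow> L') at_bot"
  shows "f summable_on UNIV"
proof -
  have main: "F summable_on UNIV" if "(\<lambda>N. F N / q ^ N) \<longlonglongrightarrow> l" for F :: "nat \<Rightarrow> complex" and l
  proof -
    have "Bseq (\<lambda>N. F N / q ^ N)"
      using that convergentI convergent_imp_Bseq by blast
    then obtain B where B: "\<And>N. norm (F N / q ^ N) \<le> B" by (auto simp: Bseq_def)
    have "summable (\<lambda>N. norm (F N))"
    proof (rule summable_comparison_test')
      show "summable (\<lambda>N. B * norm q ^ N)" using q by (intro summable_mult) auto
      show "norm (norm (F N)) \<le> B * norm q ^ N" if "N \<ge> 0" for N
        using B[of N] q by (simp add: norm_divide norm_power divide_simps mult_ac)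
    qed
    then show ?thesis by (rule norm_summable_imp_summable_on)
  qed
  have "(\<lambda>N. f (int N) / q powi int N) \<longlonglongrightarrow> L"
    by (rule filterlim_compose[OF top filterlim_int_sequentially])
  then have "(\<lambda>N. f (int N)) summable_on UNIV" by (intro main) simp
  then have 1: "f summable_on range int"
    by (subst summable_on_reindex) (auto simp: o_def)
  have "filterlim (\<lambda>N. - int N) at_bot sequentially"
    by (rule filterlim_compose[OF filterlim_uminus_at_bot_int filterlim_int_sequentially])
  then have "(\<lambda>N. f (- int N) * q powi (- int N)) \<longlonglongrightarrow> L'"
    by (rule filterlim_compose[OF bot])
  then have "(\<lambda>N. f (- int N)) summable_on UNIV"
    by (intro main) (simp add: power_int_minus field_simps)
  then have 2: "f summable_on range (\<lambda>N. - int N)"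
    by (subst summable_on_reindex) (auto simp: o_def inj_on_def)
  have "UNIV = range int \<union> (range (\<lambda>N. - int N))"
    by (auto simp: image_iff) (metis nat_0_le int_nat_eq minus_minus nle_le neg_0_le_iff_le)
  then show ?thesis using summable_on_union[OF 1 2] by simp
qed

lemma infsum_int_telescope:
  fixes f W :: "int \<Rightarrow> complex"
  assumes f: "f summable_on UNIV" and W: "\<And>n. f n = W (n - 1) - W n"
    and top: "(W \<longlongrightarrow> wp) at_top" and bot: "(W \<longlongrightarrow> wm) at_bot"
  shows "infsum f UNIV = wm - wp"
proof (rule LIMSEQ_unique)
  have "filterlim (\<lambda>N. {- int N .. int N}) (finite_subsets_at_top UNIV) sequentially"
    unfolding filterlim_finite_subsets_at_top
  proof safe
    fix X :: "int set" assume X: "finite X"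
    obtain m where m: "\<And>y. y \<in> X \<Longrightarrow> nat \<bar>y\<bar> \<le> m"
      using finite_nat_set_iff_bounded_le[of "(\<lambda>y. nat \<bar>y\<bar>) ` X"] X by auto
    show "\<forall>\<^sub>F N in sequentially. finite {- int N .. int N} \<and> X \<subseteq> {- int N .. int N} \<and> {- int N .. int N} \<subseteq> UNIV"
      using eventually_ge_at_top[of m]
      by eventually_elim (use m in force)
  qed
  then show "(\<lambda>N. \<Sum>n\<in>{- int N .. int N}. f n) \<longlonglongrightarrow> infsum f UNIV"
    using infsum_tendsto[OF f] filterlim_compose by blast
  have tele: "(\<Sum>n\<in>{- int N .. int N}. f n) = W (- int N - 1) - W (int N)" for N
  proof (induction N)
    case (Suc N)
    have "{- int (Suc N) .. int (Suc N)} = insert (- int N - 1) (insert (int N + 1) {- int N .. int N})"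
      by auto
    then show ?case using Suc.IH by (simp add: W add.commute)
  qed (simp add: W)
  have "filterlim (\<lambda>N. - int N) at_bot sequentially"
    by (rule filterlim_compose[OF filterlim_uminus_at_bot_int filterlim_int_sequentially])
  then have "(\<lambda>N. W (- int N)) \<longlonglongrightarrow> wm" by (rule filterlim_compose[OF bot])
  then have "(\<lambda>N. W (- int (Suc N))) \<longlonglongrightarrow> wm" by (subst filterlim_sequentially_Suc)
  moreover have "(\<lambda>N. W (int N)) \<longlonglongrightarrow> wp"
    by (rule filterlim_compose[OF top filterlim_int_sequentially])
  ultimately show "(\<lambda>N. \<Sum>n\<in>{- int N .. int N}. f n) \<longlonglongrightarrow> wm - wp"
    unfolding tele by (intro tendsto_diff) (simp_all add: add.commute minus_diff_commute)
qed

text \<open>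
  Transfers the limit of the outward quotients, which are indexed by natural numbers, to the
  lower end of the lattice.
\<close>

lemma tendsto_at_bot_int:
  fixes f :: "int \<Rightarrow> complex"
  assumes "(\<lambda>N. f (- int N)) \<longlonglongrightarrow> L"
  shows "(f \<longlongrightarrow> L) at_bot"
proof -
  have "filterlim (\<lambda>n::int. nat (- n)) sequentially at_bot"
    unfolding filterlim_at_top
  proof
    fix Z show "\<forall>\<^sub>F n::int in at_bot. Z \<le> nat (- n)"
      using eventually_le_at_bot[of "- int Z"] by eventually_elim auto
  qed
  then have "((\<lambda>n. f (- int (nat (- n)))) \<longlongrightarrow> L) at_bot"
    using filterlim_compose[OF assms] by blast
  moreover have "\<forall>\<^sub>F n in at_bot. f (- int (nat (- n))) = f n"
    using eventually_le_at_bot[of 0] by eventually_elim auto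
  ultimately show ?thesis by (rule Lim_transform_eventually)
qed

text \<open>
  The lattice through \<open>q \<xi>\<close> is the lattice through \<open>\<xi>\<close>, so it is immaterial whether \<open>\<xi>\<close> moves
  with \<open>x\<close> under a \<open>q\<close>-shift.
\<close>

lemma jackson_q_shift:
  assumes q: "q \<noteq> 0"
  shows "jackson q (q * \<xi>) f = jackson q \<xi> f"
    and "jackson q (inverse q * \<xi>) f = jackson q \<xi> f"
proof -
  show *: "jackson q (q * \<xi>) f = jackson q \<xi> f" for \<xi>
  proof -
    have bij: "bij_betw (\<lambda>n::int. n + 1) UNIV UNIV"
      by (rule bij_betwI[where g = "\<lambda>n. n - 1"]) auto
    have "q powi n * (q * \<xi>) = q powi (n + 1) * \<xi>" for n
      using q by (simp add: power_int_add)
    then show ?thesis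
      unfolding jackson_def
      using infsum_reindex_bij_betw[OF bij, of "\<lambda>n. q powi n * \<xi> * f (q powi n * \<xi>)"] by (simp only:)
  qed
  show "jackson q (inverse q * \<xi>) f = jackson q \<xi> f"
    using *[of "inverse q * \<xi>"] q by (simp add: mult.assoc[symmetric])
qed

section \<open>The algebraic identity for the kernel\<close>

text \<open>
  The duality of the operators with all powers of \<open>q\<close> replaced by free parameters: \<open>m\<close> and \<open>r\<close>
  stand for \<open>q powr \<mu>\<^sub>0\<close> and \<open>q powr \<chi>\<close>, \<open>w\<close> and \<open>w'\<close> for \<open>q powr \<alpha>\<^sub>1\<close> and \<open>q powr \<alpha>\<^sub>2\<close>, the \<open>u\<close>
  and \<open>v\<close> for the zeros of the coefficients of the operator in \<open>s\<close>, and \<open>P0\<close>, \<open>Pu\<close>, \<open>Pd\<close> for the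
  kernel at \<open>s\<close>, \<open>q s\<close> and \<open>s / q\<close>. In the coefficient of \<open>Pu\<close> the terms linear in \<open>u1\<close>, \<open>u2\<close>
  agree on both sides, and the rest of the difference contains the linear factor of the
  recurrence; the same happens for \<open>Pd\<close>. After these replacements every term is a multiple of
  \<open>P0\<close>, and the diagonal coefficients are exactly what remains.
\<close>

lemma kernel_identity:
  fixes q x s :: complex
  assumes nz: "q \<noteq> 0" "x \<noteq> 0" "s \<noteq> 0"
    and up: "P0 * (1 - m * s / x) = Pu * (1 - m * q * r * s / x)"
    and down: "Pd * (1 - m * s / (q * x)) = P0 * (1 - m * r * s / x)"
  shows "w / x * (x - m * r * u1) * (x - m * r * u2) * Pu
       + w' / x * (x - m * v1) * (x - m * v2) * Pd
       - ((w + w') * x + (w * m^2 * r * u1 * u2 / q + w' * m^2 * r * q * v1 * v2) / x) * P0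
     = w * m * r / (q * s) * (q * s - u1) * (q * s - u2) * Pu
       + w' * m * q / s * (s / q - v1) * (s / q - v2) * Pd
       - (m * (w + w' * r) * s + (w * m * r * u1 * u2 / q + w' * m * q * v1 * v2) / s) * P0"
proof -
  have "w / x * (x - m * r * u1) * (x - m * r * u2) - w * m * r / (q * s) * (q * s - u1) * (q * s - u2)
      = (1 - m * q * r * s / x) * (w * (x - m * r * u1 * u2 / (q * s)))"
    using nz by (simp add: divide_simps) algebra
  then have 1: "(w / x * (x - m * r * u1) * (x - m * r * u2) - w * m * r / (q * s) * (q * s - u1) * (q * s - u2)) * Pu
      = P0 * ((1 - m * s / x) * (w * (x - m * r * u1 * u2 / (q * s))))"
    using up by (simp add: mult_ac)
  have "w' / x * (x - m * v1) * (x - m * v2) - w' * m * q / s * (s / q - v1) * (s / q - v2)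
      = (1 - m * s / (q * x)) * (w' * (x - m * q * v1 * v2 / s))"
    using nz by (simp add: divide_simps) algebra
  then have 2: "(w' / x * (x - m * v1) * (x - m * v2) - w' * m * q / s * (s / q - v1) * (s / q - v2)) * Pd
      = P0 * ((1 - m * r * s / x) * (w' * (x - m * q * v1 * v2 / s)))"
    using down by (simp add: mult_ac)
  have "(1 - m * s / x) * (w * (x - m * r * u1 * u2 / (q * s))) + (1 - m * r * s / x) * (w' * (x - m * q * v1 * v2 / s))
      = ((w + w') * x + (w * m^2 * r * u1 * u2 / q + w' * m^2 * r * q * v1 * v2) / x)
       - (m * (w + w' * r) * s + (w * m * r * u1 * u2 / q + w' * m * q * v1 * v2) / s)"
    using nz by (simp add: divide_simps) algebra
  with 1 2 show ?thesis
    by algebra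
qed

section \<open>Lattices and the kernel on them\<close>

text \<open>
  The summation lattice \<open>c q\<^sup>\<int>\<close> together with the branches of the logarithm. Powers of \<open>q\<close> are
  written \<open>e\<close>, to keep the exponent laws apart from the power functions \<open>exp (a * lg t)\<close> of a
  variable.
\<close>

locale q_lattice =
  fixes q lq :: complex and lg :: "complex \<Rightarrow> complex" and c :: complex
  assumes q_nz: "q \<noteq> 0" and q_lt_1: "norm q < 1"
    and log: "q_log_branch q lq lg" and c_nz: "c \<noteq> 0"
begin

abbreviation e :: "complex \<Rightarrow> complex" where
  "e a \<equiv> exp (a * lq)"

definition s :: "int \<Rightarrow> complex" where
  "s n = q powi n * c"

lemma e_1: "e 1 = q"
  using log by (simp add: q_log_branch_def)

lemma e_add: "e (a + b) = e a * e b"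
  by (simp add: distrib_right exp_add)

lemma e_uminus: "e (- a) = inverse (e a)"
  by (simp add: exp_minus)

lemma lg_q_mult: "y \<noteq> 0 \<Longrightarrow> lg (q * y) = lq + lg y"
  using log by (simp add: q_log_branch_def)

lemma lg_q_inverse_mult: "y \<noteq> 0 \<Longrightarrow> lg (inverse q * y) = lg y - lq"
  using lg_q_mult[of "inverse q * y"] q_nz by (simp add: field_simps)

lemma s_nz: "s n \<noteq> 0"
  using q_nz c_nz by (simp add: s_def)

lemma s_succ: "s (n + 1) = q * s n"
  and s_pred: "s (n - 1) = s n / q"
  using q_nz by (simp_all add: s_def power_int_add power_int_diff)

lemma exp_lg_s: "exp (lg (s n)) = s n"
  using log s_nz by (simp add: q_log_branch_def)

lemma pow_s_succ: "exp (a * lg (s (n + 1))) = e a * exp (a * lg (s n))"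
  by (simp add: s_succ lg_q_mult s_nz distrib_left exp_add)

lemma pow_s_add: "exp ((a + b) * lg (s n)) = exp (a * lg (s n)) * exp (b * lg (s n))"
  by (simp add: distrib_right exp_add)

lemma s_mult_pow: "s n * exp (a * lg (s n)) = exp ((a + 1) * lg (s n))"
  by (simp add: pow_s_add exp_lg_s)

lemma pow_s_uminus_nat: "exp (a * lg (s (- int N))) = exp (a * lg c) * e (- a) ^ N"
proof (induction N)
  case (Suc N)
  have "exp (a * lg (s (- int N))) = e a * exp (a * lg (s (- int (Suc N))))"
    using pow_s_succ[of a "- int (Suc N)"] by simp
  then have "exp (a * lg (s (- int (Suc N)))) = inverse (e a) * exp (a * lg (s (- int N)))"
    by simp
  then show ?case unfolding Suc.IH e_uminus by (simp only: power_Suc mult_ac)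
qed (simp add: s_def)

lemma tendsto_s: "(s \<longlongrightarrow> 0) at_top"
  and tendsto_inverse_s: "((\<lambda>n. inverse (s n)) \<longlongrightarrow> 0) at_bot"
proof -
  have pow: "(\<lambda>N. q ^ N) \<longlonglongrightarrow> 0" by (intro LIMSEQ_power_zero q_lt_1)
  have "(\<lambda>N. q ^ N * inverse c) \<longlonglongrightarrow> 0 * inverse c" by (intro tendsto_intros pow)
  then show "((\<lambda>n. inverse (s n)) \<longlongrightarrow> 0) at_bot"
    by (intro tendsto_at_bot_int) (simp add: s_def power_int_minus)
  have "(\<lambda>N. q ^ N * c) \<longlonglongrightarrow> 0 * c" by (intro tendsto_intros pow)
  then have "(\<lambda>N. s (- (- int N))) \<longlonglongrightarrow> 0" by (simp add: s_def)
  then have "((\<lambda>n. s (- n)) \<longlongrightarrow> 0) at_bot" by (rule tendsto_at_bot_int)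
  then have "((\<lambda>n. s (- (- n))) \<longlongrightarrow> 0) at_top"
    by (rule filterlim_compose[OF _ filterlim_uminus_at_bot_int])
  then show "(s \<longlongrightarrow> 0) at_top" by simp
qed

lemma tendsto_succ_at_top: "(f \<longlongrightarrow> l) at_top \<Longrightarrow> ((\<lambda>n::int. f (n + 1)) \<longlongrightarrow> l) at_top"
  and tendsto_succ_at_bot: "(f \<longlongrightarrow> l) at_bot \<Longrightarrow> ((\<lambda>n::int. f (n + 1)) \<longlongrightarrow> l) at_bot"
  for f :: "int \<Rightarrow> complex"
proof -
  have "filterlim (\<lambda>n::int. n + 1) at_top at_top"
    unfolding filterlim_at_top
  proof
    fix Z :: int
    show "\<forall>\<^sub>F n in at_top. Z \<le> n + 1" using eventually_ge_at_top[of Z] by eventually_elim simp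
  qed
  then show "(f \<longlongrightarrow> l) at_top \<Longrightarrow> ((\<lambda>n::int. f (n + 1)) \<longlongrightarrow> l) at_top"
    by (rule filterlim_compose[rotated])
  have "filterlim (\<lambda>n::int. n + 1) at_bot at_bot"
    unfolding filterlim_at_bot
  proof
    fix Z :: int
    show "\<forall>\<^sub>F n in at_bot. n + 1 \<le> Z" using eventually_le_at_bot[of "Z - 1"] by eventually_elim simp
  qed
  then show "(f \<longlongrightarrow> l) at_bot \<Longrightarrow> ((\<lambda>n::int. f (n + 1)) \<longlongrightarrow> l) at_bot"
    by (rule filterlim_compose[rotated])
qed

definition pole_free :: "complex \<Rightarrow> complex \<Rightarrow> bool" where
  "pole_free \<mu>0 y \<longleftrightarrow> y \<noteq> 0 \<and> (\<forall>n. qpoch_inf q (e \<mu>0 * s n / y) \<noteq> 0)"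

text \<open>
  The kernel depends on \<open>s / y\<close> only.
\<close>

lemma P1_q_shift:
  shows "P1 q lq \<mu> \<mu>0 (q * y) (s n) = P1 q lq \<mu> \<mu>0 y (s (n - 1))"
    and "P1 q lq \<mu> \<mu>0 (inverse q * y) (s n) = P1 q lq \<mu> \<mu>0 y (s (n + 1))"
  unfolding P1_def s_succ s_pred using q_nz by (simp_all add: field_simps)

lemma pole_free_q_shift:
  assumes "pole_free \<mu>0 y"
  shows "pole_free \<mu>0 (q * y)" and "pole_free \<mu>0 (inverse q * y)"
proof -
  have "e \<mu>0 * s n / (q * y) = e \<mu>0 * s (n - 1) / y"
    and "e \<mu>0 * s n / (inverse q * y) = e \<mu>0 * s (n + 1) / y" for n
    unfolding s_succ s_pred using q_nz by (simp_all add: field_simps)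
  then show "pole_free \<mu>0 (q * y)" and "pole_free \<mu>0 (inverse q * y)"
    using assms q_nz by (simp_all add: pole_free_def)
qed

lemma P1_rec:
  assumes "pole_free \<mu>0 y"
  shows "P1 q lq \<mu> \<mu>0 y (s n) * (1 - e \<mu>0 * s n / y) = P1 q lq \<mu> \<mu>0 y (s (n + 1)) * (1 - e \<mu> * s n / y)"
proof -
  have rec: "qpoch_inf q (e a * s n / y) = (1 - e a * s n / y) * qpoch_inf q (e a * s (n + 1) / y)" for a
    using qpoch_inf_rec[OF q_lt_1, of "e a * s n / y"] by (simp add: s_succ mult_ac)
  have "1 - e \<mu>0 * s n / y \<noteq> 0"
    using assms rec[of \<mu>0] unfolding pole_free_def by (metis mult_zero_left)
  then show ?thesis unfolding P1_def rec[of \<mu>] rec[of \<mu>0] by simp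
qed

lemma P1_at_top:
  "((\<lambda>n. P1 q lq \<mu> \<mu>0 y (s n)) \<longlongrightarrow> 1) at_top"
proof -
  have "((\<lambda>n. e a * s n / y) \<longlongrightarrow> 0) at_top" for a
    using tendsto_mult[OF tendsto_const[of "e a / y"] tendsto_s] by simp
  then have "((\<lambda>n. P1 q lq \<mu> \<mu>0 y (s n)) \<longlongrightarrow> 1 / 1) at_top"
    unfolding P1_def by (intro tendsto_divide tendsto_qpoch_inf_1 q_lt_1) auto
  then show ?thesis by simp
qed

text \<open>
  At infinity \<open>P\<close> is asymptotically a power of \<open>s\<close> times a \<open>q\<close>-periodic function, and on a
  single lattice the latter is constant. This constant is the theta quotient in \<open>g\<^sub>2\<close>,
  multiplied by a power of \<open>c\<close>.
\<close>

lemma P1_at_bot: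
  assumes "pole_free \<mu>0 y"
  shows "((\<lambda>n. exp ((\<mu> - \<mu>0) * lg (s n)) * P1 q lq \<mu> \<mu>0 y (s n)) \<longlongrightarrow>
    qtheta q (e (1 - \<mu>) * y / c) / qtheta q (e (1 - \<mu>0) * y / c) * exp ((\<mu> - \<mu>0) * lg c)) at_bot"
proof (rule tendsto_at_bot_int)
  define a where "a = e \<mu> * c / y"
  define b where "b = e \<mu>0 * c / y"
  have y: "y \<noteq> 0" using assms by (simp add: pole_free_def)
  have ab: "a \<noteq> 0" "b \<noteq> 0" using y c_nz by (simp_all add: a_def b_def)
  have sN: "e \<nu> * s (- int N) / y = e \<nu> * c / y / q ^ N" for \<nu> N
    by (simp add: s_def power_int_minus field_simps)
  have nz: "qpoch_inf q (b / q ^ N) \<noteq> 0" for N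
    using assms sN[of \<mu>0 N] unfolding pole_free_def b_def by metis
  have theta: "q / (e \<nu> * c / y) = e (1 - \<nu>) * y / c" for \<nu>
    using y c_nz e_1 by (simp add: left_diff_distrib exp_diff field_simps)
  have ba: "b / a = e (- (\<mu> - \<mu>0))"
    using y c_nz by (simp add: a_def b_def left_diff_distrib exp_diff)
  have "(\<lambda>N. (b / a) ^ N * (qpoch_inf q (a / q ^ N) / qpoch_inf q (b / q ^ N)) * exp ((\<mu> - \<mu>0) * lg c))
      \<longlonglongrightarrow> qtheta q (q / a) / qtheta q (q / b) * exp ((\<mu> - \<mu>0) * lg c)"
    by (intro tendsto_mult_right qpoch_inf_quotient_backward_LIMSEQ q_nz q_lt_1 ab nz)
  moreover have "exp ((\<mu> - \<mu>0) * lg (s (- int N))) * P1 q lq \<mu> \<mu>0 y (s (- int N)) =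
      (b / a) ^ N * (qpoch_inf q (a / q ^ N) / qpoch_inf q (b / q ^ N)) * exp ((\<mu> - \<mu>0) * lg c)" for N
    unfolding ba pow_s_uminus_nat P1_def sN by (simp only: a_def b_def mult_ac)
  ultimately show "(\<lambda>N. exp ((\<mu> - \<mu>0) * lg (s (- int N))) * P1 q lq \<mu> \<mu>0 y (s (- int N))) \<longlonglongrightarrow>
      qtheta q (e (1 - \<mu>) * y / c) / qtheta q (e (1 - \<mu>0) * y / c) * exp ((\<mu> - \<mu>0) * lg c)"
    unfolding theta[symmetric] a_def b_def by (simp only:)
qed

section \<open>Convergence and boundary terms\<close>

text \<open>
  The bilinear expression whose differences appear in the summation by parts; \<open>a\<close> and \<open>b\<close> are
  the coefficients of the downward and the upward shift.
\<close>

definition boundary ::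
  "(complex \<Rightarrow> complex) \<Rightarrow> complex \<Rightarrow> complex \<Rightarrow> complex \<Rightarrow>
    (complex \<Rightarrow> complex) \<Rightarrow> (complex \<Rightarrow> complex) \<Rightarrow> complex \<Rightarrow> int \<Rightarrow> complex" where
  "boundary h p \<mu> \<mu>0 a b y n =
     exp ((1 - p) * lg (s n)) * P1 q lq \<mu> \<mu>0 y (s n) * b (s n) * h (s (n + 1))
   - exp ((1 - p) * lg (s (n + 1))) * P1 q lq \<mu> \<mu>0 y (s (n + 1)) * a (s (n + 1)) * h (s n)"

context
  fixes h :: "complex \<Rightarrow> complex" and p \<alpha>' \<mu> \<mu>0 C1 C2 :: complex
  assumes at_zero: "((\<lambda>n. h (s n) / exp (p * lg (s n))) \<longlongrightarrow> C1) at_top"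
    and at_infinity: "((\<lambda>n. h (s n) / exp (- \<alpha>' * lg (s n))) \<longlongrightarrow> C2) at_bot"
    and balance: "p + \<alpha>' + (\<mu> - \<mu>0) = 2"
begin

text \<open>
  Near the origin the summand is \<open>s\<close> times a convergent factor, hence of order \<open>q\<^sup>n\<close>. At
  infinity the exponents of \<open>s\<close>, of \<open>h\<close> and of the kernel add up to \<open>1 - p - \<alpha>' - (\<mu> - \<mu>0) = -1\<close>
  by the balance condition, so the summand is of order \<open>1 / s\<close>.
\<close>

lemma jackson_integrand_converges:
  assumes y: "pole_free \<mu>0 y"
  shows "jackson_converges q c (\<lambda>t. exp (- p * lg t) * h t * P1 q lq \<mu> \<mu>0 y t)"
  unfolding jackson_converges_def s_def[symmetric]
proof (rule summable_on_int_if_geometric[OF q_nz q_lt_1])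
  let ?f = "\<lambda>n. s n * (exp (- p * lg (s n)) * h (s n) * P1 q lq \<mu> \<mu>0 y (s n))"
  let ?\<Lambda> = "qtheta q (e (1 - \<mu>) * y / c) / qtheta q (e (1 - \<mu>0) * y / c) * exp ((\<mu> - \<mu>0) * lg c)"
  have "?f n / q powi n = c * (h (s n) / exp (p * lg (s n))) * P1 q lq \<mu> \<mu>0 y (s n)" for n
    using q_nz by (simp add: s_def exp_minus field_simps)
  moreover have "((\<lambda>n. c * (h (s n) / exp (p * lg (s n))) * P1 q lq \<mu> \<mu>0 y (s n)) \<longlongrightarrow> c * C1 * 1) at_top"
    by (intro tendsto_intros at_zero P1_at_top)
  ultimately show "((\<lambda>n. ?f n / q powi n) \<longlongrightarrow> c * C1 * 1) at_top" by (simp only:)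
  have "?f n * q powi n = (h (s n) / exp (- \<alpha>' * lg (s n))) *
      (exp ((\<mu> - \<mu>0) * lg (s n)) * P1 q lq \<mu> \<mu>0 y (s n)) / c" for n
  proof -
    have "p = 1 + 1 + - \<alpha>' + - (\<mu> - \<mu>0)" using balance by (simp add: algebra_simps)
    then have p: "exp (p * lg (s n)) = s n * s n * exp (- \<alpha>' * lg (s n)) * exp (- (\<mu> - \<mu>0) * lg (s n))"
      by (simp only: pow_s_add mult_1 exp_lg_s)
    define X where "X = exp (- \<alpha>' * lg (s n))"
    define Y where "Y = exp ((\<mu> - \<mu>0) * lg (s n))"
    have XY: "X \<noteq> 0" "Y \<noteq> 0" by (simp_all add: X_def Y_def)
    have p': "exp (- p * lg (s n)) = inverse (s n * s n * X * inverse Y)"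
      unfolding minus_mult_left[symmetric] exp_minus p X_def Y_def ..
    have qn: "q powi n = s n / c" using c_nz by (simp add: s_def)
    show ?thesis
      unfolding p' qn X_def[symmetric] Y_def[symmetric] using XY c_nz s_nz[of n] by (simp add: divide_simps)
  qed
  moreover have "((\<lambda>n. (h (s n) / exp (- \<alpha>' * lg (s n))) *
      (exp ((\<mu> - \<mu>0) * lg (s n)) * P1 q lq \<mu> \<mu>0 y (s n)) / c) \<longlongrightarrow> C2 * ?\<Lambda> / c) at_bot"
    by (intro tendsto_intros at_infinity P1_at_bot y c_nz)
  ultimately show "((\<lambda>n. ?f n * q powi n) \<longlongrightarrow> C2 * ?\<Lambda> / c) at_bot" by (simp only:)
qed

text \<open>
  The kernel tends to 1, and the powers of \<open>s\<close> from the kernel and from \<open>h\<close> leave one factor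
  \<open>s\<close>, which cancels the simple poles of the coefficients. The powers \<open>e p\<close> and \<open>e (- p)\<close> come
  from the shift by one lattice step between \<open>h\<close> and the kernel.
\<close>

lemma boundary_at_zero:
  assumes a: "((\<lambda>n. s n * a (s n)) \<longlongrightarrow> A) at_top" and b: "((\<lambda>n. s n * b (s n)) \<longlongrightarrow> B) at_top"
  shows "(boundary h p \<mu> \<mu>0 a b y \<longlongrightarrow> C1 * (e p * B - e (- p) * A)) at_top"
proof -
  let ?P = "\<lambda>n. P1 q lq \<mu> \<mu>0 y (s n)" and ?h = "\<lambda>n. h (s n) / exp (p * lg (s n))"
  have pow: "exp ((1 - p) * lg (s n)) = s n / exp (p * lg (s n))" for n
    by (simp add: left_diff_distrib exp_diff exp_lg_s)
  have "boundary h p \<mu> \<mu>0 a b y n = e p * ?P n * (s n * b (s n)) * ?h (n + 1)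
      - e (- p) * ?P (n + 1) * (s (n + 1) * a (s (n + 1))) * ?h n" for n
    unfolding boundary_def pow pow_s_succ[of p] e_uminus by (simp add: divide_simps)
  moreover have "((\<lambda>n. e p * ?P n * (s n * b (s n)) * ?h (n + 1)
      - e (- p) * ?P (n + 1) * (s (n + 1) * a (s (n + 1))) * ?h n) \<longlongrightarrow>
      e p * 1 * B * C1 - e (- p) * 1 * A * C1) at_top"
    by (intro tendsto_intros P1_at_top at_zero b tendsto_succ_at_top[OF P1_at_top]
        tendsto_succ_at_top[OF at_zero] tendsto_succ_at_top[OF a])
  ultimately have "(boundary h p \<mu> \<mu>0 a b y \<longlongrightarrow> e p * 1 * B * C1 - e (- p) * 1 * A * C1) at_top"
    by presburger
  then show ?thesis by (simp add: algebra_simps)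
qed

text \<open>
  The balance condition makes the total exponent of \<open>s\<close> vanish when the coefficients grow
  linearly, so both terms have finite limits.
\<close>

lemma boundary_at_infinity:
  assumes y: "pole_free \<mu>0 y"
    and a: "((\<lambda>n. a (s n) / s n) \<longlongrightarrow> A) at_bot" and b: "((\<lambda>n. b (s n) / s n) \<longlongrightarrow> B) at_bot"
  shows "(boundary h p \<mu> \<mu>0 a b y \<longlongrightarrow>
    C2 * (qtheta q (e (1 - \<mu>) * y / c) / qtheta q (e (1 - \<mu>0) * y / c) * exp ((\<mu> - \<mu>0) * lg c))
      * (e (- \<alpha>') * B - e \<alpha>' * A)) at_bot"
proof -
  let ?\<Lambda> = "qtheta q (e (1 - \<mu>) * y / c) / qtheta q (e (1 - \<mu>0) * y / c) * exp ((\<mu> - \<mu>0) * lg c)"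
  let ?P = "\<lambda>n. exp ((\<mu> - \<mu>0) * lg (s n)) * P1 q lq \<mu> \<mu>0 y (s n)"
    and ?h = "\<lambda>n. h (s n) / exp (- \<alpha>' * lg (s n))"
  have pow: "exp ((1 - p) * lg (s n)) = exp (\<alpha>' * lg (s n)) * exp ((\<mu> - \<mu>0) * lg (s n)) / s n" for n
  proof -
    have "1 - p = \<alpha>' + (\<mu> - \<mu>0) + - 1" using balance by (simp add: algebra_simps)
    then show ?thesis by (simp only: pow_s_add) (simp add: exp_minus exp_lg_s field_simps)
  qed
  have "boundary h p \<mu> \<mu>0 a b y n = e (- \<alpha>') * ?P n * (b (s n) / s n) * ?h (n + 1)
      - e \<alpha>' * ?P (n + 1) * (a (s (n + 1)) / s (n + 1)) * ?h n" for n
    unfolding boundary_def pow pow_s_succ[of \<alpha>'] pow_s_succ[of "- \<alpha>'"] e_uminus minus_mult_left[symmetric] exp_minus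
    by (simp add: divide_simps)
  moreover have "((\<lambda>n. e (- \<alpha>') * ?P n * (b (s n) / s n) * ?h (n + 1)
      - e \<alpha>' * ?P (n + 1) * (a (s (n + 1)) / s (n + 1)) * ?h n) \<longlongrightarrow>
      e (- \<alpha>') * ?\<Lambda> * B * C2 - e \<alpha>' * ?\<Lambda> * A * C2) at_bot"
    by (intro tendsto_diff tendsto_mult tendsto_const P1_at_bot y at_infinity b tendsto_succ_at_bot[OF P1_at_bot[OF y]]
        tendsto_succ_at_bot[OF at_infinity] tendsto_succ_at_bot[OF a])
  ultimately have "(boundary h p \<mu> \<mu>0 a b y \<longlongrightarrow> e (- \<alpha>') * ?\<Lambda> * B * C2 - e \<alpha>' * ?\<Lambda> * A * C2) at_bot"
    by presburger
  moreover have "e (- \<alpha>') * l * B * C2 - e \<alpha>' * l * A * C2 = C2 * l * (e (- \<alpha>') * B - e \<alpha>' * A)" for l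
    by (simp add: algebra_simps)
  ultimately show ?thesis by (simp only:)
qed

end

text \<open>
  Both shift coefficients are of this form. They have a simple pole at the origin and grow
  linearly at infinity, and the boundary terms depend on the leading coefficients there only.
\<close>

lemma quadratic_at_zero: "((\<lambda>n. s n * (k * inverse (s n) * (s n - u) * (s n - v))) \<longlongrightarrow> k * u * v) at_top"
proof -
  have "s n * (k * inverse (s n) * (s n - u) * (s n - v)) = k * (s n - u) * (s n - v)" for n
    using s_nz[of n] by simp
  moreover have "((\<lambda>n. k * (s n - u) * (s n - v)) \<longlongrightarrow> k * (0 - u) * (0 - v)) at_top"
    by (intro tendsto_intros tendsto_s)
  ultimately show ?thesis by (simp only: diff_0 mult_minus_left mult_minus_right minus_minus)
qed

lemma quadratic_at_infinity: "((\<lambda>n. k * inverse (s n) * (s n - u) * (s n - v) / s n) \<longlongrightarrow> k) at_bot"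
proof -
  have "k * inverse (s n) * (s n - u) * (s n - v) / s n = k * (1 - u * inverse (s n)) * (1 - v * inverse (s n))" for n
    using s_nz[of n] by (simp add: field_simps)
  moreover have "((\<lambda>n. k * (1 - u * inverse (s n)) * (1 - v * inverse (s n))) \<longlongrightarrow> k * (1 - u * 0) * (1 - v * 0)) at_bot"
    by (intro tendsto_intros tendsto_inverse_s)
  ultimately show ?thesis by simp
qed

end

section \<open>Duality of the operators\<close>

definition A4_lower where
  "A4_lower lq t1 t2 h1 h2 x =
     inverse x * (x - exp ((h1 + 1/2) * lq) * t1) * (x - exp ((h2 + 1/2) * lq) * t2)"
  for lq :: complex

definition A4_upper where
  "A4_upper lq t1 t2 l1 l2 \<alpha>1 \<alpha>2 x =
     exp ((\<alpha>1 + \<alpha>2) * lq) * inverse x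
       * (x - exp ((l1 - 1/2) * lq) * t1) * (x - exp ((l2 - 1/2) * lq) * t2)"
  for lq :: complex

definition A4_diag where
  "A4_diag lq t1 t2 h1 h2 l1 l2 \<alpha>1 \<alpha>2 \<beta> x =
     (exp (\<alpha>1 * lq) + exp (\<alpha>2 * lq)) * x
      + exp ((h1 + h2 + l1 + l2 + \<alpha>1 + \<alpha>2) / 2 * lq)
          * (exp (\<beta> / 2 * lq) + exp (- \<beta> / 2 * lq)) * t1 * t2 * inverse x"
  for lq :: complex

lemma A4_eq:
  "A4 q lq t1 t2 h1 h2 l1 l2 \<alpha>1 \<alpha>2 \<beta> g x =
     A4_lower lq t1 t2 h1 h2 x * g (inverse q * x)
   + A4_upper lq t1 t2 l1 l2 \<alpha>1 \<alpha>2 x * g (q * x)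
   - A4_diag lq t1 t2 h1 h2 l1 l2 \<alpha>1 \<alpha>2 \<beta> x * g x"
  by (simp add: A4_def A4_lower_def A4_upper_def A4_diag_def)

context q_lattice
begin

text \<open>
  The factors \<open>e (1 - p)\<close> and \<open>e (p - 1)\<close> come from shifting \<open>s powr (1 - p)\<close> and \<open>e \<alpha>1\<close>, \<open>e (-
  \<alpha>1)\<close> from shifting \<open>x powr (- \<alpha>1)\<close>, so that the identity involves the kernel \<open>P\<close> alone. On the
  right the coefficients are evaluated at the neighbouring points because the operator is
  transposed. The relations between the two sets of parameters are what makes the coefficients
  match those of \<open>kernel_identity\<close>.
\<close>

lemma A4_kernel_duality:
  fixes h1' h2' l1' l2' \<alpha>1' \<alpha>2' \<beta>' \<mu>0 \<alpha>1 t1 t2 x :: complex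
  defines "\<chi>' \<equiv> (l1' + l2' - h1' - h2' - \<alpha>1' + \<alpha>2' - \<beta>') / 2"
  defines "\<alpha>2 \<equiv> \<alpha>1 - \<alpha>1' + \<alpha>2' - \<chi>'"
    and "p \<equiv> (h1' + h2' - l1' - l2' - \<alpha>1' - \<alpha>2' + \<beta>' + 2) / 2"
  defines "P \<equiv> \<lambda>n. P1 q lq (\<mu>0 + 1 + \<chi>') \<mu>0 x (s n)"
  assumes x: "pole_free \<mu>0 x"
  shows "A4_lower lq t1 t2 (h1' + \<mu>0 + \<chi>') (h2' + \<mu>0 + \<chi>') x * e \<alpha>1 * P (n + 1)
       + A4_upper lq t1 t2 (l1' + \<mu>0) (l2' + \<mu>0) \<alpha>1 \<alpha>2 x * e (- \<alpha>1) * P (n - 1)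
       - A4_diag lq t1 t2 (h1' + \<mu>0 + \<chi>') (h2' + \<mu>0 + \<chi>') (l1' + \<mu>0) (l2' + \<mu>0) \<alpha>1 \<alpha>2 (- \<beta>' - \<chi>') x * P n
     = e (\<mu>0 + \<alpha>1 - \<alpha>1') *
       (A4_lower lq t1 t2 h1' h2' (s (n + 1)) * e (1 - p) * P (n + 1)
       + A4_upper lq t1 t2 l1' l2' \<alpha>1' \<alpha>2' (s (n - 1)) * e (p - 1) * P (n - 1)
       - A4_diag lq t1 t2 h1' h2' l1' l2' \<alpha>1' \<alpha>2' \<beta>' (s n) * P n)"
proof -
  define m r w w' where "m = e \<mu>0" and "r = e \<chi>'" and "w = e \<alpha>1" and "w' = e \<alpha>2"
  define u1 u2 v1 v2 where "u1 = e (h1' + 1/2) * t1" and "u2 = e (h2' + 1/2) * t2"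
    and "v1 = e (l1' - 1/2) * t1" and "v2 = e (l2' - 1/2) * t2"
  note defs = m_def r_def w_def w'_def u1_def u2_def v1_def v2_def
  have x_nz: "x \<noteq> 0" using x by (simp add: pole_free_def)
  have e_mult: "e a * e b = e (a + b)" for a b by (simp add: e_add)
  have e_m1: "a / q = a * e (- 1)" for a unfolding e_uminus e_1 divide_inverse ..
  have mq: "e (\<mu>0 + 1 + \<chi>') = m * q * r" unfolding e_add e_1 m_def r_def ..
  have up: "P n * (1 - m * s n / x) = P (n + 1) * (1 - m * q * r * s n / x)"
    using P1_rec[OF x, of "\<mu>0 + 1 + \<chi>'" n] unfolding P_def mq m_def .
  have down: "P (n - 1) * (1 - m * s n / (q * x)) = P n * (1 - m * r * s n / x)"
    using P1_rec[OF x, of "\<mu>0 + 1 + \<chi>'" "n - 1"] q_nz unfolding P_def mq m_def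
    by (simp add: s_pred)
  note kernel = kernel_identity[OF q_nz x_nz s_nz up down, of w u1 u2 w' v1 v2]

  have arg: "e (a + \<mu>0 + \<chi>' + 1/2) = m * r * e (a + 1/2)" "e (a + \<mu>0 - 1/2) = m * e (a - 1/2)" for a
    unfolding m_def r_def e_mult by (simp_all add: algebra_simps)
  have lower: "A4_lower lq t1 t2 (h1' + \<mu>0 + \<chi>') (h2' + \<mu>0 + \<chi>') x * e \<alpha>1 =
      w / x * (x - m * r * u1) * (x - m * r * u2)"
    unfolding A4_lower_def arg w_def u1_def u2_def by (simp only: divide_inverse mult_ac)
  have upper: "A4_upper lq t1 t2 (l1' + \<mu>0) (l2' + \<mu>0) \<alpha>1 \<alpha>2 x * e (- \<alpha>1) =
      w' / x * (x - m * v1) * (x - m * v2)"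
  proof -
    have "w' = e (\<alpha>1 + \<alpha>2) * e (- \<alpha>1)" unfolding e_mult w'_def by simp
    then show ?thesis
      unfolding A4_upper_def arg v1_def v2_def by (simp only: divide_inverse mult_ac)
  qed
  define k where "k = e (\<mu>0 + \<alpha>1 - \<alpha>1')"
  \<comment> \<open>The constant in the diagonal coefficient is a sum of two monomials, multiples of the products of the \<open>u\<close> and of the \<open>v\<close>.
     In the operator in \<open>x\<close> the exponent \<open>\<beta> / 2\<close> belongs to the product of the \<open>u\<close>, in the operator in \<open>s\<close> it is \<open>- \<beta>' / 2\<close>;
     hence the exchanged order in the second equation.\<close>
  have spread: "e a * (e b + e b') * t1 * t2 = e (a + b) * t1 * t2 + e (a + b') * t1 * t2"
    and spread': "e a0 * (e a * (e b + e b') * t1 * t2) = e (a0 + a + b') * t1 * t2 + e (a0 + a + b) * t1 * t2"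
    for a0 a b b'
    unfolding e_add by algebra+
  have diag_consts:
    "e ((h1' + \<mu>0 + \<chi>' + (h2' + \<mu>0 + \<chi>') + (l1' + \<mu>0) + (l2' + \<mu>0) + \<alpha>1 + \<alpha>2) / 2) *
      (e ((- \<beta>' - \<chi>') / 2) + e (- (- \<beta>' - \<chi>') / 2)) * t1 * t2
      = w * m^2 * r * u1 * u2 / q + w' * m^2 * r * q * v1 * v2"
  proof -
    have "w * m^2 * r * u1 * u2 / q = e (\<alpha>1 + \<mu>0 + \<mu>0 + \<chi>' + (h1' + 1/2) + (h2' + 1/2) + - 1) * t1 * t2"
      unfolding defs e_m1 e_add power2_eq_square by (simp only: mult_ac)
    moreover have "w' * m^2 * r * q * v1 * v2 = e (\<alpha>2 + \<mu>0 + \<mu>0 + \<chi>' + (l1' - 1/2) + (l2' - 1/2) + 1) * t1 * t2"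
      unfolding defs e_1[symmetric] e_add power2_eq_square by (simp only: mult_ac)
    moreover have "(h1' + \<mu>0 + \<chi>' + (h2' + \<mu>0 + \<chi>') + (l1' + \<mu>0) + (l2' + \<mu>0) + \<alpha>1 + \<alpha>2) / 2 + (- \<beta>' - \<chi>') / 2
        = \<alpha>1 + \<mu>0 + \<mu>0 + \<chi>' + (h1' + 1/2) + (h2' + 1/2) + - 1"
      and "(h1' + \<mu>0 + \<chi>' + (h2' + \<mu>0 + \<chi>') + (l1' + \<mu>0) + (l2' + \<mu>0) + \<alpha>1 + \<alpha>2) / 2 + - (- \<beta>' - \<chi>') / 2
        = \<alpha>2 + \<mu>0 + \<mu>0 + \<chi>' + (l1' - 1/2) + (l2' - 1/2) + 1"
      unfolding \<alpha>2_def \<chi>'_def by (simp_all add: field_simps)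
    ultimately show ?thesis
      by (simp only: spread)
  qed
  have diag: "A4_diag lq t1 t2 (h1' + \<mu>0 + \<chi>') (h2' + \<mu>0 + \<chi>') (l1' + \<mu>0) (l2' + \<mu>0) \<alpha>1 \<alpha>2 (- \<beta>' - \<chi>') x =
      (w + w') * x + (w * m^2 * r * u1 * u2 / q + w' * m^2 * r * q * v1 * v2) / x"
    unfolding A4_diag_def diag_consts w_def w'_def by (simp add: divide_inverse)

  have "k * e (1 - p) = w * m * r" "k * e (\<alpha>1' + \<alpha>2') * e (p - 1) = w' * m"
    unfolding k_def defs e_mult p_def \<alpha>2_def \<chi>'_def by (simp_all add: field_simps)
  moreover have "k * (A4_lower lq t1 t2 h1' h2' (s (n + 1)) * e (1 - p)) =
      (k * e (1 - p)) / (q * s n) * (q * s n - u1) * (q * s n - u2)"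
    unfolding A4_lower_def u1_def u2_def s_succ by (simp only: divide_inverse mult_ac)
  moreover have "k * (A4_upper lq t1 t2 l1' l2' \<alpha>1' \<alpha>2' (s (n - 1)) * e (p - 1)) =
      (k * e (\<alpha>1' + \<alpha>2') * e (p - 1)) * q / s n * (s n / q - v1) * (s n / q - v2)"
    unfolding A4_upper_def v1_def v2_def s_pred by (simp only: divide_inverse inverse_mult_distrib inverse_inverse_eq mult_ac)
  ultimately have lower': "k * (A4_lower lq t1 t2 h1' h2' (s (n + 1)) * e (1 - p)) =
      w * m * r / (q * s n) * (q * s n - u1) * (q * s n - u2)"
    and upper': "k * (A4_upper lq t1 t2 l1' l2' \<alpha>1' \<alpha>2' (s (n - 1)) * e (p - 1)) =
      w' * m * q / s n * (s n / q - v1) * (s n / q - v2)"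
    by (simp_all only:)
  have diag_consts': "k * (e ((h1' + h2' + l1' + l2' + \<alpha>1' + \<alpha>2') / 2) * (e (\<beta>' / 2) + e (- \<beta>' / 2)) * t1 * t2)
      = w * m * r * u1 * u2 / q + w' * m * q * v1 * v2"
  proof -
    have "w * m * r * u1 * u2 / q = e (\<alpha>1 + \<mu>0 + \<chi>' + (h1' + 1/2) + (h2' + 1/2) + - 1) * t1 * t2"
      unfolding defs e_m1 e_add power2_eq_square by (simp only: mult_ac)
    moreover have "w' * m * q * v1 * v2 = e (\<alpha>2 + \<mu>0 + (l1' - 1/2) + (l2' - 1/2) + 1) * t1 * t2"
      unfolding defs e_1[symmetric] e_add power2_eq_square by (simp only: mult_ac)
    moreover have "\<mu>0 + \<alpha>1 - \<alpha>1' + (h1' + h2' + l1' + l2' + \<alpha>1' + \<alpha>2') / 2 + - \<beta>' / 2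
        = \<alpha>1 + \<mu>0 + \<chi>' + (h1' + 1/2) + (h2' + 1/2) + - 1"
      and "\<mu>0 + \<alpha>1 - \<alpha>1' + (h1' + h2' + l1' + l2' + \<alpha>1' + \<alpha>2') / 2 + \<beta>' / 2
        = \<alpha>2 + \<mu>0 + (l1' - 1/2) + (l2' - 1/2) + 1"
      unfolding \<alpha>2_def \<chi>'_def by (simp_all add: field_simps)
    ultimately show ?thesis
      by (simp only: k_def spread')
  qed
  have "k * e \<alpha>1' = m * w" "k * e \<alpha>2' = m * w' * r"
    unfolding k_def defs e_mult \<alpha>2_def by (simp_all add: algebra_simps)
  then have mw: "m * (w + w' * r) = k * (e \<alpha>1' + e \<alpha>2')"
    by (simp add: algebra_simps)
  have diag': "k * A4_diag lq t1 t2 h1' h2' l1' l2' \<alpha>1' \<alpha>2' \<beta>' (s n) =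
      m * (w + w' * r) * s n + (w * m * r * u1 * u2 / q + w' * m * q * v1 * v2) / s n"
    unfolding A4_diag_def diag_consts'[symmetric] mw
    by (simp only: distrib_left distrib_right divide_inverse mult.assoc)
  show ?thesis
    unfolding lower upper diag kernel k_def[symmetric] lower'[symmetric] upper'[symmetric] diag'[symmetric]
    by (simp only: right_diff_distrib[of k] distrib_left[of k] mult.assoc)
qed

section \<open>Summation by parts\<close>

text \<open>
  The theorem for one fixed lattice. The summand of \<open>A G - k * E' * G\<close>, with \<open>k = e (\<mu>0 + \<alpha>1 -
  \<alpha>1')\<close>, is rewritten by \<open>A4_kernel_duality\<close> and the equation for \<open>h\<close> as a difference of
  boundary terms, and the sum is then read off from their limits.
\<close>

lemma A4_jackson:
  fixes h1' h2' l1' l2' \<alpha>1' \<alpha>2' \<beta>' \<mu>0 \<alpha>1 t1 t2 x E' C1 C2 :: complex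
    and h :: "complex \<Rightarrow> complex"
  defines "\<chi>' \<equiv> (l1' + l2' - h1' - h2' - \<alpha>1' + \<alpha>2' - \<beta>') / 2"
    and "p \<equiv> (h1' + h2' - l1' - l2' - \<alpha>1' - \<alpha>2' + \<beta>' + 2) / 2"
  defines "\<mu> \<equiv> \<mu>0 + 1 + \<chi>'" and "\<alpha>2 \<equiv> \<alpha>1 - \<alpha>1' + \<alpha>2' - \<chi>'"
  defines "G \<equiv> \<lambda>y. exp (- \<alpha>1 * lg y) * jackson q c (\<lambda>t. exp (- p * lg t) * h t * P1 q lq \<mu> \<mu>0 y t)"
  assumes x: "pole_free \<mu>0 x"
    and eq: "\<And>n. A4 q lq t1 t2 h1' h2' l1' l2' \<alpha>1' \<alpha>2' \<beta>' h (s n) = E' * h (s n)"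
    and at_zero: "((\<lambda>n. h (s n) / exp (p * lg (s n))) \<longlongrightarrow> C1) at_top"
    and at_infinity: "((\<lambda>n. h (s n) / exp (- \<alpha>1' * lg (s n))) \<longlongrightarrow> C2) at_bot"
  shows "jackson_converges q c (\<lambda>t. exp (- p * lg t) * h t * P1 q lq \<mu> \<mu>0 x t)"
    and "A4 q lq t1 t2 (h1' + \<mu>0 + \<chi>') (h2' + \<mu>0 + \<chi>') (l1' + \<mu>0) (l2' + \<mu>0) \<alpha>1 \<alpha>2 (- \<beta>' - \<chi>') G x =
      e (\<mu>0 + \<alpha>1 - \<alpha>1') * E' * G x + (1 - q) *
        (C2 * exp (- \<alpha>1 * lg x)
            * (qtheta q (e (- \<mu>0 - \<chi>') * x / c) / qtheta q (e (- \<mu>0 + 1) * x / c))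
            * exp ((\<chi>' + 1) * lg c) * e (\<mu>0 + \<alpha>1) * (e (\<alpha>2' - \<alpha>1') - 1)
         - C1 * exp (- \<alpha>1 * lg x) * e (\<mu>0 + \<alpha>1 + h1' + h2' + \<chi>') * (e \<beta>' - 1) * t1 * t2)"
proof -
  have balance: "p + \<alpha>1' + (\<mu> - \<mu>0) = 2"
    by (simp add: p_def \<mu>_def \<chi>'_def field_simps)
  note limits = at_zero at_infinity balance
  show "jackson_converges q c (\<lambda>t. exp (- p * lg t) * h t * P1 q lq \<mu> \<mu>0 x t)"
    by (rule jackson_integrand_converges[OF limits x])

  have x_nz: "x \<noteq> 0" using x by (simp add: pole_free_def)
  define F where "F y n = s n * (exp (- p * lg (s n)) * h (s n) * P1 q lq \<mu> \<mu>0 y (s n))" for y n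
  have F_summable: "F y summable_on UNIV" if "pole_free \<mu>0 y" for y
    using jackson_integrand_converges[OF limits that]
    by (simp add: jackson_converges_def F_def[abs_def] s_def[symmetric])
  have G_eq: "G y = exp (- \<alpha>1 * lg y) * ((1 - q) * infsum (F y) UNIV)" for y
    by (simp add: G_def jackson_def F_def[abs_def] s_def)
  define P where "P n = P1 q lq \<mu> \<mu>0 x (s n)" for n
  define S where "S n = exp ((1 - p) * lg (s n))" for n
  have F_x: "F x n = S n * P n * h (s n)"
    and F_up: "F (q * x) n = S n * P (n - 1) * h (s n)"
    and F_down: "F (inverse q * x) n = S n * P (n + 1) * h (s n)" for n
    unfolding F_def P1_q_shift P_def[symmetric] S_def
    using s_mult_pow[of n "- p"] by (simp_all add: mult_ac)
  have S_succ: "S (n + 1) = e (1 - p) * S n" for n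
    unfolding S_def by (rule pow_s_succ)
  have S_pred: "S (n - 1) = e (p - 1) * S n" for n
  proof -
    have "S n = e (1 - p) * S (n - 1)" using S_succ[of "n - 1"] by simp
    moreover have "e (p - 1) * e (1 - p) = 1" by (simp add: mult_exp_exp flip: distrib_right)
    ultimately show ?thesis by (metis mult.assoc mult_1)
  qed

  define a b d where "a = A4_lower lq t1 t2 h1' h2'" and "b = A4_upper lq t1 t2 l1' l2' \<alpha>1' \<alpha>2'"
    and "d = A4_diag lq t1 t2 h1' h2' l1' l2' \<alpha>1' \<alpha>2' \<beta>'"
  define ax bx dx where
      "ax = A4_lower lq t1 t2 (h1' + \<mu>0 + \<chi>') (h2' + \<mu>0 + \<chi>') x"
    and "bx = A4_upper lq t1 t2 (l1' + \<mu>0) (l2' + \<mu>0) \<alpha>1 \<alpha>2 x"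
    and "dx = A4_diag lq t1 t2 (h1' + \<mu>0 + \<chi>') (h2' + \<mu>0 + \<chi>') (l1' + \<mu>0) (l2' + \<mu>0) \<alpha>1 \<alpha>2 (- \<beta>' - \<chi>') x"
  define k where "k = e (\<mu>0 + \<alpha>1 - \<alpha>1')"
  have h_eq: "E' * h (s n) = a (s n) * h (s (n - 1)) + b (s n) * h (s (n + 1)) - d (s n) * h (s n)" for n
    using eq[of n] q_nz unfolding A4_eq a_def b_def d_def s_succ s_pred
    by (simp add: divide_inverse mult.commute)
  have kernel: "ax * e \<alpha>1 * P (n + 1) + bx * e (- \<alpha>1) * P (n - 1) - dx * P n =
      k * (a (s (n + 1)) * e (1 - p) * P (n + 1) + b (s (n - 1)) * e (p - 1) * P (n - 1) - d (s n) * P n)" for n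
    unfolding ax_def bx_def dx_def k_def a_def b_def d_def P_def \<mu>_def \<alpha>2_def p_def \<chi>'_def
    by (rule A4_kernel_duality[OF x])

  define W where "W = boundary h p \<mu> \<mu>0 a b x"
  \<comment> \<open>The summand of \<open>A G - k * E' * G\<close>, without the factor \<open>x powr (- \<alpha>1) * (1 - q)\<close>.\<close>
  define D where "D n = ax * e \<alpha>1 * F (inverse q * x) n + bx * e (- \<alpha>1) * F (q * x) n + - dx * F x n
      + - (k * E') * F x n" for n
  have D_eq: "D n = k * W (n - 1) - k * W n" for n
  proof -
    have "D n = S n * h (s n) * (ax * e \<alpha>1 * P (n + 1) + bx * e (- \<alpha>1) * P (n - 1) - dx * P n)
        - k * S n * P n * (E' * h (s n))"
      unfolding D_def F_x F_up F_down by (simp add: algebra_simps)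
    also have "\<dots> = k * (S (n - 1) * P (n - 1) * b (s (n - 1)) * h (s n) - S n * P n * a (s n) * h (s (n - 1)))
        - k * (S n * P n * b (s n) * h (s (n + 1)) - S (n + 1) * P (n + 1) * a (s (n + 1)) * h (s n))"
      unfolding kernel h_eq S_succ S_pred by algebra
    also have "\<dots> = k * W (n - 1) - k * W n"
      by (simp add: W_def boundary_def P_def S_def)
    finally show ?thesis .
  qed
  let ?\<Theta> = "qtheta q (e (1 - \<mu>) * x / c) / qtheta q (e (1 - \<mu>0) * x / c) * exp ((\<mu> - \<mu>0) * lg c)"
  define u1 u2 v1 v2 where "u1 = e (h1' + 1/2) * t1" and "u2 = e (h2' + 1/2) * t2"
    and "v1 = e (l1' - 1/2) * t1" and "v2 = e (l2' - 1/2) * t2"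
  \<comment> \<open>The factor 1 makes the first coefficient an instance of the quadratic limits, too.\<close>
  have ab: "a = (\<lambda>y. 1 * inverse y * (y - u1) * (y - u2))"
      "b = (\<lambda>y. e (\<alpha>1' + \<alpha>2') * inverse y * (y - v1) * (y - v2))"
    by (simp_all add: a_def b_def A4_lower_def[abs_def] A4_upper_def[abs_def] u1_def u2_def v1_def v2_def)
  have W_top: "(W \<longlongrightarrow> C1 * (e p * (e (\<alpha>1' + \<alpha>2') * v1 * v2) - e (- p) * (1 * u1 * u2))) at_top"
    unfolding W_def ab by (rule boundary_at_zero[OF limits quadratic_at_zero quadratic_at_zero])
  have W_bot: "(W \<longlongrightarrow> C2 * ?\<Theta> * (e (- \<alpha>1') * e (\<alpha>1' + \<alpha>2') - e \<alpha>1' * 1)) at_bot"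
    unfolding W_def ab by (rule boundary_at_infinity[OF limits x quadratic_at_infinity quadratic_at_infinity])
  have F': "F (inverse q * x) summable_on UNIV" "F (q * x) summable_on UNIV" "F x summable_on UNIV"
    using F_summable pole_free_q_shift x by blast+
  have D_sum: "(D has_sum (ax * e \<alpha>1 * infsum (F (inverse q * x)) UNIV + bx * e (- \<alpha>1) * infsum (F (q * x)) UNIV
      + - dx * infsum (F x) UNIV + - (k * E') * infsum (F x) UNIV)) UNIV"
    unfolding D_def[abs_def] by (intro has_sum_add has_sum_cmult_right has_sum_infsum F')
  have "infsum D UNIV = k * (C2 * ?\<Theta> * (e (- \<alpha>1') * e (\<alpha>1' + \<alpha>2') - e \<alpha>1' * 1))
      - k * (C1 * (e p * (e (\<alpha>1' + \<alpha>2') * v1 * v2) - e (- p) * (1 * u1 * u2)))"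
    by (rule infsum_int_telescope[OF has_sum_imp_summable[OF D_sum] D_eq tendsto_mult_left[OF W_top] tendsto_mult_left[OF W_bot]])
  moreover note infsumI[OF D_sum]
  moreover have "k * (e (- \<alpha>1') * e (\<alpha>1' + \<alpha>2') - e \<alpha>1' * 1) = e (\<mu>0 + \<alpha>1) * (e (\<alpha>2' - \<alpha>1') - 1)"
    unfolding k_def mult_1_right right_diff_distrib mult_exp_exp by (simp add: algebra_simps)
  moreover have "k * (e p * (e (\<alpha>1' + \<alpha>2') * v1 * v2) - e (- p) * (1 * u1 * u2))
      = e (\<mu>0 + \<alpha>1 + h1' + h2' + \<chi>') * (e \<beta>' - 1) * t1 * t2"
  proof -
    have "k * (e p * (e (\<alpha>1' + \<alpha>2') * v1 * v2)) = e (\<mu>0 + \<alpha>1 - \<alpha>1' + p + (\<alpha>1' + \<alpha>2') + (l1' - 1/2) + (l2' - 1/2)) * t1 * t2"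
      and "k * (e (- p) * (1 * u1 * u2)) = e (\<mu>0 + \<alpha>1 - \<alpha>1' + - p + (h1' + 1/2) + (h2' + 1/2)) * t1 * t2"
      and "e (\<mu>0 + \<alpha>1 + h1' + h2' + \<chi>') * (e \<beta>' - 1) * t1 * t2 =
        e (\<mu>0 + \<alpha>1 + h1' + h2' + \<chi>' + \<beta>') * t1 * t2 - e (\<mu>0 + \<alpha>1 + h1' + h2' + \<chi>') * t1 * t2"
      unfolding k_def u1_def u2_def v1_def v2_def e_add mult_1 by algebra+
    moreover have "\<mu>0 + \<alpha>1 - \<alpha>1' + p + (\<alpha>1' + \<alpha>2') + (l1' - 1/2) + (l2' - 1/2) = \<mu>0 + \<alpha>1 + h1' + h2' + \<chi>' + \<beta>'"
      and "\<mu>0 + \<alpha>1 - \<alpha>1' + - p + (h1' + 1/2) + (h2' + 1/2) = \<mu>0 + \<alpha>1 + h1' + h2' + \<chi>'"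
      by (simp_all add: p_def \<chi>'_def field_simps)
    ultimately show ?thesis unfolding right_diff_distrib[of k] by (simp only:)
  qed
  ultimately have sums: "ax * e \<alpha>1 * infsum (F (inverse q * x)) UNIV + bx * e (- \<alpha>1) * infsum (F (q * x)) UNIV
      - dx * infsum (F x) UNIV = k * E' * infsum (F x) UNIV
      + (C2 * ?\<Theta> * (e (\<mu>0 + \<alpha>1) * (e (\<alpha>2' - \<alpha>1') - 1)) - C1 * (e (\<mu>0 + \<alpha>1 + h1' + h2' + \<chi>') * (e \<beta>' - 1) * t1 * t2))"
    by algebra
  have exponents: "1 - \<mu> = - \<mu>0 - \<chi>'" "1 - \<mu>0 = - \<mu>0 + 1" "\<mu> - \<mu>0 = \<chi>' + 1"
    by (simp_all add: \<mu>_def)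
  have pow_down: "exp (- \<alpha>1 * lg (inverse q * x)) = exp (- \<alpha>1 * lg x) * e \<alpha>1"
    and pow_up: "exp (- \<alpha>1 * lg (q * x)) = exp (- \<alpha>1 * lg x) * e (- \<alpha>1)"
    unfolding lg_q_inverse_mult[OF x_nz] lg_q_mult[OF x_nz] mult_exp_exp by (simp_all add: algebra_simps)
  have "A4 q lq t1 t2 (h1' + \<mu>0 + \<chi>') (h2' + \<mu>0 + \<chi>') (l1' + \<mu>0) (l2' + \<mu>0) \<alpha>1 \<alpha>2 (- \<beta>' - \<chi>') G x
      = exp (- \<alpha>1 * lg x) * (1 - q) * (ax * e \<alpha>1 * infsum (F (inverse q * x)) UNIV
        + bx * e (- \<alpha>1) * infsum (F (q * x)) UNIV - dx * infsum (F x) UNIV)"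
    unfolding A4_eq ax_def[symmetric] bx_def[symmetric] dx_def[symmetric] G_eq pow_down pow_up by algebra
  also have "\<dots> = k * E' * G x + (1 - q) *
      (C2 * exp (- \<alpha>1 * lg x) * ?\<Theta> * e (\<mu>0 + \<alpha>1) * (e (\<alpha>2' - \<alpha>1') - 1)
       - C1 * exp (- \<alpha>1 * lg x) * e (\<mu>0 + \<alpha>1 + h1' + h2' + \<chi>') * (e \<beta>' - 1) * t1 * t2)"
    unfolding sums G_eq by algebra
  finally show "A4 q lq t1 t2 (h1' + \<mu>0 + \<chi>') (h2' + \<mu>0 + \<chi>') (l1' + \<mu>0) (l2' + \<mu>0) \<alpha>1 \<alpha>2 (- \<beta>' - \<chi>') G x =
      e (\<mu>0 + \<alpha>1 - \<alpha>1') * E' * G x + (1 - q) *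
        (C2 * exp (- \<alpha>1 * lg x)
            * (qtheta q (e (- \<mu>0 - \<chi>') * x / c) / qtheta q (e (- \<mu>0 + 1) * x / c))
            * exp ((\<chi>' + 1) * lg c) * e (\<mu>0 + \<alpha>1) * (e (\<alpha>2' - \<alpha>1') - 1)
         - C1 * exp (- \<alpha>1 * lg x) * e (\<mu>0 + \<alpha>1 + h1' + h2' + \<chi>') * (e \<beta>' - 1) * t1 * t2)"
    unfolding exponents k_def by (simp only: mult.assoc)
qed

end

theorem theorem4p1:
  fixes q lq :: complex and lg :: "complex \<Rightarrow> complex"
    and t1 t2 h1' h2' l1' l2' \<alpha>1' \<alpha>2' \<beta>' \<mu>0 \<alpha>1 :: complex
    and \<xi> h g g1 g2 :: "complex \<Rightarrow> complex"
    and E' C1 C2 chi \<mu> E \<beta> \<alpha>2 h1 h2 l1 l2 x :: complex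
  assumes q: "0 < norm q" "norm q < 1"
    and log: "q_log_branch q lq lg"
    and x: "x \<noteq> 0"
    and xi: "(\<exists>c. c \<noteq> 0 \<and> \<xi> = (\<lambda>y. c)) \<or> (\<exists>A. A \<noteq> 0 \<and> \<xi> = (\<lambda>y. A * y))"
    and defined: "\<And>n::int. qpoch_inf q (exp (\<mu>0 * lq) * (q powi n * \<xi> x) / x) \<noteq> 0"
    and eq: "\<And>n::int. A4 q lq t1 t2 h1' h2' l1' l2' \<alpha>1' \<alpha>2' \<beta>' h (q powi n * \<xi> x)
                       = E' * h (q powi n * \<xi> x)"
    and lim1: "((\<lambda>L::int. h (q powi L * \<xi> x) /
                   exp ((h1' + h2' - l1' - l2' - \<alpha>1' - \<alpha>2' + \<beta>' + 2) / 2 * lg (q powi L * \<xi> x)))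
                \<longlongrightarrow> C1) at_top"
    and lim2: "((\<lambda>K::int. h (q powi K * \<xi> x) / exp (- \<alpha>1' * lg (q powi K * \<xi> x)))
                \<longlongrightarrow> C2) at_bot"
    and "chi = (l1' + l2' - h1' - h2' - \<alpha>1' + \<alpha>2' - \<beta>') / 2"
    and "\<mu> = \<mu>0 + 1 + chi"
    and "E = exp ((\<mu>0 + \<alpha>1 - \<alpha>1') * lq) * E'"
    and "\<beta> = - \<beta>' - chi"
    and "\<alpha>2 = \<alpha>1 - \<alpha>1' + \<alpha>2' - chi"
    and "l1 = l1' + \<mu>0" and "l2 = l2' + \<mu>0"
    and "h1 = h1' + \<mu>0 + chi" and "h2 = h2' + \<mu>0 + chi"
    and "g = (\<lambda>y. exp (- \<alpha>1 * lg y) * jackson q (\<xi> y)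
               (\<lambda>s. exp (- ((h1' + h2' - l1' - l2' - \<alpha>1' - \<alpha>2' + \<beta>' + 2) / 2) * lg s)
                      * h s * P1 q lq \<mu> \<mu>0 y s))"
    and "g1 = (\<lambda>y. C1 * exp (- \<alpha>1 * lg y) * exp ((\<mu>0 + \<alpha>1 + h1' + h2' + chi) * lq)
               * (exp (\<beta>' * lq) - 1) * t1 * t2)"
    and "g2 = (\<lambda>y. C2 * exp (- \<alpha>1 * lg y)
               * (qtheta q (exp ((- \<mu>0 - chi) * lq) * y / \<xi> y)
                  / qtheta q (exp ((- \<mu>0 + 1) * lq) * y / \<xi> y))
               * exp ((chi + 1) * lg (\<xi> y)) * exp ((\<mu>0 + \<alpha>1) * lq)
               * (exp ((\<alpha>2' - \<alpha>1') * lq) - 1))"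
  shows "jackson_converges q (\<xi> x)
           (\<lambda>s. exp (- ((h1' + h2' - l1' - l2' - \<alpha>1' - \<alpha>2' + \<beta>' + 2) / 2) * lg s)
                  * h s * P1 q lq \<mu> \<mu>0 x s)
       \<and> A4 q lq t1 t2 h1 h2 l1 l2 \<alpha>1 \<alpha>2 \<beta> g x = E * g x + (1 - q) * (g2 x - g1 x)
       \<and> (C1 = 0 \<and> C2 = 0 \<longrightarrow> A4 q lq t1 t2 h1 h2 l1 l2 \<alpha>1 \<alpha>2 \<beta> g x = E * g x)"
proof -
  interpret q_lattice q lq lg "\<xi> x"
    using q log x xi by unfold_locales auto
  have pole_free: "pole_free \<mu>0 x"
    using x defined by (simp add: pole_free_def s_def)
  \<comment> \<open>Only the points \<open>x\<close>, \<open>q x\<close> and \<open>x / q\<close> enter, and the lattices belonging to them coincide, also for \<open>\<xi> = A x\<close>.\<close>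
  have jackson_xi: "jackson q (\<xi> y) f = jackson q (\<xi> x) f" if "y \<in> {x, q * x, inverse q * x}" for y f
    using xi that jackson_q_shift[OF q_nz, of "\<xi> x" f] by (auto simp: mult.left_commute)
  define G where "G y = exp (- \<alpha>1 * lg y) * jackson q (\<xi> x)
      (\<lambda>s. exp (- ((h1' + h2' - l1' - l2' - \<alpha>1' - \<alpha>2' + \<beta>' + 2) / 2) * lg s)
        * h s * P1 q lq \<mu> \<mu>0 y s)" for y
  have "g y = G y" if "y \<in> {x, q * x, inverse q * x}" for y
    unfolding assms(19) G_def jackson_xi[OF that] ..
  then have g: "g x = G x" "A4 q lq t1 t2 h1 h2 l1 l2 \<alpha>1 \<alpha>2 \<beta> g x = A4 q lq t1 t2 h1 h2 l1 l2 \<alpha>1 \<alpha>2 \<beta> G x"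
    by (simp_all add: A4_eq)
  note main = A4_jackson[OF pole_free eq[folded s_def] lim1[folded s_def] lim2[folded s_def]]
  have conv: "jackson_converges q (\<xi> x)
      (\<lambda>s. exp (- ((h1' + h2' - l1' - l2' - \<alpha>1' - \<alpha>2' + \<beta>' + 2) / 2) * lg s) * h s * P1 q lq \<mu> \<mu>0 x s)"
    using main(1) unfolding assms(10,11) .
  have "A4 q lq t1 t2 h1 h2 l1 l2 \<alpha>1 \<alpha>2 \<beta> G x = E * G x + (1 - q) * (g2 x - g1 x)"
    using main(2)[where ?\<alpha>1.0 = \<alpha>1] unfolding assms(10-18) assms(20,21) G_def[abs_def] .
  with g conv show ?thesis
    using assms(20,21) by simp
qed

end
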